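(* Let $n\ge 1$ and $0\le m\le\binom n2$ be integers. Every threshold graph $T$ with $n$ vertices and $m$ edges that is $J$-extremal is isomorphic to $L(q,m)\cup E_{n-q}$ for some integer $q$ with $0\le q\le n$ (i.e., $T$ is the disjoint union of a lex graph and an empty graph).
   Context: $J$ is the graph (with loops) on three vertices $a,b,c$ whose edges are $ab$ and a loop at $b$; $c$ is an isolated unlooped vertex. A homomorphism from a simple graph $G$ to $J$ is a map $\phi:V(G)\to V(J)$ with $\phi(x)\phi(y)\in E(J)$ whenever $xy\in E(G)$; write $j(G)$ for the number of homomorphisms from $G$ to $J$. A graph $G$ with $n$ vertices and $m$ edges is $J$-extremal if $j(G)\geq j(G')$ for every simple graph $G'$ with $n$ vertices and $m$ edges. A threshold graph is a graph obtained from $K_1$ by repeatedly adding either a vertex adjacent to all existing vertices or an isolated vertex. $E_r$ is the edgeless graph on $r$ vertices. The lexicographic order on subsets of $[q]$ is defined by $A<B$ iff $\min(A\triangle B)\in A$; the lex graph $L(q,m)$ (for $m\le\binom q2$) has vertex set $[q]$ and edge set the first $m$ two-element subsets of $[q]$ in this order. *)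

theory Defs
  imports "HOL-Library.FuncSet" "HOL-Library.Ramsey"
begin

(* An edge xy is the set {x, y}, so that a loop at x is the singleton {x}. *)
datatype 'a graph = Graph (verts: "'a set") (edges: "'a set set")

definition simple_graph :: "'a graph \<Rightarrow> bool" where
  "simple_graph G \<longleftrightarrow> finite (verts G) \<and> edges G \<subseteq> [verts G]\<^bsup>2\<^esup>"

definition graph_iso :: "'a graph \<Rightarrow> 'b graph \<Rightarrow> bool" where
  "graph_iso G H \<longleftrightarrow>
     (\<exists>f. bij_betw f (verts G) (verts H) \<and>
          (\<forall>x \<in> verts G. \<forall>y \<in> verts G. {x, y} \<in> edges G \<longleftrightarrow> {f x, f y} \<in> edges H))"

definition disjoint_union :: "'a graph \<Rightarrow> 'b graph \<Rightarrow> ('a + 'b) graph" where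
  "disjoint_union G H =
     Graph (verts G <+> verts H) ((`) Inl ` edges G \<union> (`) Inr ` edges H)"

(* Homomorphisms are extensional functions (undefined off verts G), so that
   each map V(G) -> V(H) is counted exactly once. *)
definition homs :: "'a graph \<Rightarrow> 'b graph \<Rightarrow> ('a \<Rightarrow> 'b) set" where
  "homs G H =
     {\<phi> \<in> verts G \<rightarrow>\<^sub>E verts H. \<forall>x y. {x, y} \<in> edges G \<longrightarrow> {\<phi> x, \<phi> y} \<in> edges H}"

datatype J_vertex = J_a | J_b | J_c

definition J :: "J_vertex graph" where
  "J = Graph {J_a, J_b, J_c} {{J_a, J_b}, {J_b}}"

definition j :: "'a graph \<Rightarrow> nat" where
  "j G = card (homs G J)"

(* Every finite graph is isomorphic to one whose vertices are natural numbers,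
   so the competitors G' range over all simple graphs up to isomorphism. *)
definition J_extremal :: "'a graph \<Rightarrow> bool" where
  "J_extremal G \<longleftrightarrow>
     simple_graph G \<and>
     (\<forall>G' :: nat graph. simple_graph G' \<and> card (verts G') = card (verts G)
        \<and> card (edges G') = card (edges G) \<longrightarrow> j G' \<le> j G)"

inductive threshold_graph :: "'a graph \<Rightarrow> bool" where
  K1: "threshold_graph (Graph {v} {})"
| dominating: "threshold_graph (Graph (insert v V) (E \<union> {{u, v} | u. u \<in> V}))"
    if "threshold_graph (Graph V E)" and "v \<notin> V"
| isolated: "threshold_graph (Graph (insert v V) E)"
    if "threshold_graph (Graph V E)" and "v \<notin> V"

definition empty_graph :: "nat \<Rightarrow> nat graph" where
  "empty_graph r = Graph {1..r} {}"

definition lex_less :: "nat set \<Rightarrow> nat set \<Rightarrow> bool" where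
  "lex_less A B \<longleftrightarrow> A \<noteq> B \<and> Min (sym_diff A B) \<in> A"

(* For m <= q choose 2, the first m pairs are those with fewer than m predecessors. *)
definition lex_graph :: "nat \<Rightarrow> nat \<Rightarrow> nat graph" where
  "lex_graph q m =
     Graph {1..q} {e \<in> [{1..q}]\<^bsup>2\<^esup>. card {f \<in> [{1..q}]\<^bsup>2\<^esup>. lex_less f e} < m}"

end

theory Submission
  imports Defs
begin

text \<open>
  Order the vertices of a threshold graph so that \<open>N(y) - {x} \<subseteq> N(x)\<close> whenever \<open>x\<close> precedes \<open>y\<close>;
  then the non-isolated vertices come first, numbered \<open>1, \<dots>, q\<close>. If the edges are not an
  initial segment of the lex order on the pairs from \<open>[q]\<close>, then some non-edge \<open>uv\<close> precedes an
  edge \<open>xy\<close>, where one may take \<open>u < x < y\<close>. Exchanging \<open>xy\<close> for \<open>uv\<close> leaves every non-isolated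
  vertex non-isolated, destroys the homomorphisms with \<open>u, v \<mapsto> a\<close>, and creates strictly more
  with \<open>x, y \<mapsto> a\<close>, so the graph was not extremal.
\<close>

section \<open>Homomorphisms into \<open>J\<close> and edges of simple graphs\<close>

lemma edges_J_iff:
  "{p, q} \<in> edges J \<longleftrightarrow> p \<noteq> J_c \<and> q \<noteq> J_c \<and> \<not> (p = J_a \<and> q = J_a)"
  by (cases p; cases q) (auto simp: J_def doubleton_eq_iff)

lemma verts_J: "verts J = UNIV"
  unfolding J_def using J_vertex.exhaust by auto

text \<open>The codomain condition is vacuous because \<open>verts J\<close> is the whole type. What
  remains says that the preimage of a is independent and that only vertices on no edge may go to
  c.\<close>

lemma homs_J_iff:
  "\<phi> \<in> homs G J \<longleftrightarrow> \<phi> \<in> extensional (verts G) \<and>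
     (\<forall>x y. {x, y} \<in> edges G \<longrightarrow> \<phi> x \<noteq> J_c \<and> \<phi> y \<noteq> J_c \<and> \<not> (\<phi> x = J_a \<and> \<phi> y = J_a))"
  by (simp add: homs_def edges_J_iff verts_J PiE_def)

lemma finite_homs_J:
  assumes "finite (verts G)"
  shows "finite (homs G J)"
proof -
  have "finite (verts G \<rightarrow>\<^sub>E verts J)"
    using assms by (intro finite_PiE) (auto simp: J_def)
  then show ?thesis
    by (rule finite_subset[rotated]) (auto simp: homs_def)
qed

lemma simple_graph_edgeD:
  assumes "simple_graph G" "{x, y} \<in> edges G"
  shows "x \<in> verts G" "y \<in> verts G" "x \<noteq> y"
proof -
  have "{x, y} \<in> [verts G]\<^bsup>2\<^esup>"
    using assms unfolding simple_graph_def by blast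
  then show "x \<in> verts G" "y \<in> verts G" "x \<noteq> y"
    by simp_all
qed

lemma simple_graph_edgeE:
  assumes "simple_graph G" "e \<in> edges G"
  obtains x y where "e = {x, y}" "x \<in> verts G" "y \<in> verts G" "x \<noteq> y"
proof -
  have "e \<in> [verts G]\<^bsup>2\<^esup>"
    using assms by (auto simp: simple_graph_def)
  then show ?thesis
    by (metis nsets2_E that)
qed

section \<open>Relabelling vertices along an injection\<close>

definition image_graph :: "('a \<Rightarrow> 'b) \<Rightarrow> 'a graph \<Rightarrow> 'b graph" where
  "image_graph f G = Graph (f ` verts G) ((`) f ` edges G)"

lemma edge_image_graph_iff:
  assumes "simple_graph G" "inj_on f (verts G)" "x \<in> verts G" "y \<in> verts G"
  shows "{f x, f y} \<in> edges (image_graph f G) \<longleftrightarrow> {x, y} \<in> edges G"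
proof
  assume "{f x, f y} \<in> edges (image_graph f G)"
  then obtain e where e: "e \<in> edges G" "f ` e = f ` {x, y}"
    by (auto simp: image_graph_def)
  moreover have "e \<subseteq> verts G"
    using e assms(1) by (auto simp: simple_graph_def nsets_def)
  ultimately show "{x, y} \<in> edges G"
    using inj_on_image_eq_iff[OF assms(2), of e "{x, y}"] assms by auto
next
  assume "{x, y} \<in> edges G"
  then have "f ` {x, y} \<in> edges (image_graph f G)"
    unfolding image_graph_def by (simp del: image_insert)
  then show "{f x, f y} \<in> edges (image_graph f G)"
    by simp
qed

lemma simple_image_graph:
  assumes "simple_graph G" "inj_on f (verts G)"
  shows "simple_graph (image_graph f G)"
  unfolding simple_graph_def
proof
  show "finite (verts (image_graph f G))"
    using assms by (auto simp: image_graph_def simple_graph_def)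
  show "edges (image_graph f G) \<subseteq> [verts (image_graph f G)]\<^bsup>2\<^esup>"
  proof
    fix e' assume "e' \<in> edges (image_graph f G)"
    then obtain e where e: "e \<in> edges G" "e' = f ` e"
      by (auto simp: image_graph_def)
    from assms(1) e(1) obtain x y where "e = {x, y}" "x \<in> verts G" "y \<in> verts G" "x \<noteq> y"
      by (rule simple_graph_edgeE)
    then show "e' \<in> [verts (image_graph f G)]\<^bsup>2\<^esup>"
      using e(2) assms(2) by (auto simp: image_graph_def inj_on_eq_iff)
  qed
qed

lemma card_image_graph:
  assumes "simple_graph G" "inj_on f (verts G)"
  shows "card (verts (image_graph f G)) = card (verts G)"
    and "card (edges (image_graph f G)) = card (edges G)"
proof -
  show "card (verts (image_graph f G)) = card (verts G)"
    using assms(2) by (simp add: image_graph_def card_image)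
  have "edges G \<subseteq> Pow (verts G)"
    using assms(1) by (auto simp: simple_graph_def nsets_def)
  then have "inj_on ((`) f) (edges G)"
    using inj_on_image_Pow[OF assms(2)] inj_on_subset by blast
  then show "card (edges (image_graph f G)) = card (edges G)"
    by (simp add: image_graph_def card_image)
qed

lemma graph_iso_image_graph:
  assumes "simple_graph G" "inj_on f (verts G)"
  shows "graph_iso G (image_graph f G)"
  unfolding graph_iso_def
  using assms edge_image_graph_iff[OF assms]
  by (intro exI[of _ f]) (auto simp: image_graph_def bij_betw_def)

lemma graph_iso_trans:
  assumes "graph_iso G H" "graph_iso H K"
  shows "graph_iso G K"
proof -
  obtain f where f: "bij_betw f (verts G) (verts H)"
    "\<And>x y. x \<in> verts G \<Longrightarrow> y \<in> verts G \<Longrightarrow> {x, y} \<in> edges G \<longleftrightarrow> {f x, f y} \<in> edges H"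
    using assms(1) unfolding graph_iso_def by blast
  obtain g where g: "bij_betw g (verts H) (verts K)"
    "\<And>x y. x \<in> verts H \<Longrightarrow> y \<in> verts H \<Longrightarrow> {x, y} \<in> edges H \<longleftrightarrow> {g x, g y} \<in> edges K"
    using assms(2) unfolding graph_iso_def by blast
  show ?thesis
    unfolding graph_iso_def
    using bij_betw_trans[OF f(1) g(1)] f g bij_betw_apply[OF f(1)]
    by (intro exI[of _ "g \<circ> f"]) auto
qed

text \<open>Precomposing with the inverse of \<open>f\<close> turns homomorphisms of
  \<open>G\<close> into homomorphisms of the image, and the original can be read off at the points
  \<open>f x\<close>. This one inequality is enough to carry extremality over to the image.\<close>

lemma j_image_graph_le:
  assumes "simple_graph G" "inj_on f (verts G)"
  shows "j G \<le> j (image_graph f G)"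
proof -
  let ?V = "verts G" and ?H = "image_graph f G"
  let ?F = "\<lambda>\<phi>. restrict (\<phi> \<circ> inv_into ?V f) (f ` ?V)"
  have eval: "?F \<phi> (f x) = \<phi> x" if "x \<in> ?V" for \<phi> :: "'a \<Rightarrow> J_vertex" and x
    using that assms(2) by simp
  have "inj_on ?F (homs G J)"
  proof (rule inj_onI)
    fix \<phi> \<psi> assume h: "\<phi> \<in> homs G J" "\<psi> \<in> homs G J" "?F \<phi> = ?F \<psi>"
    have "\<phi> x = \<psi> x" if "x \<in> ?V" for x
      using eval[OF that] h(3) by metis
    then show "\<phi> = \<psi>"
      using h by (auto simp: homs_J_iff intro: extensionalityI)
  qed
  moreover have "?F \<phi> \<in> homs ?H J" if \<phi>: "\<phi> \<in> homs G J" for \<phi>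
    unfolding homs_J_iff
  proof (intro conjI[of "_ \<in> extensional _"] allI impI)
    show "?F \<phi> \<in> extensional (verts ?H)"
      by (simp add: image_graph_def)
    fix x' y' assume e: "{x', y'} \<in> edges ?H"
    then have "x' \<in> f ` ?V" "y' \<in> f ` ?V"
      using simple_graph_edgeD[OF simple_image_graph[OF assms] e] by (auto simp: image_graph_def)
    then obtain x y where xy: "x' = f x" "y' = f y" "x \<in> ?V" "y \<in> ?V"
      by auto
    then have "{x, y} \<in> edges G"
      using e edge_image_graph_iff[OF assms] by simp
    then show "?F \<phi> x' \<noteq> J_c \<and> ?F \<phi> y' \<noteq> J_c \<and> \<not> (?F \<phi> x' = J_a \<and> ?F \<phi> y' = J_a)"
      using \<phi> unfolding xy(1,2) eval[OF xy(3)] eval[OF xy(4)] homs_J_iff by blast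
  qed
  moreover have "finite (homs ?H J)"
    using simple_image_graph[OF assms] by (simp add: finite_homs_J simple_graph_def)
  ultimately show ?thesis
    unfolding j_def by (intro card_inj_on_le[of ?F]) auto
qed

text \<open>A competitor of the image has the same vertex and edge counts as \<open>G\<close>, so it
  is bounded by \<open>j G\<close>, which is at most \<open>j\<close> of the image.\<close>

lemma J_extremal_image_graph:
  fixes f :: "'a \<Rightarrow> 'b"
  assumes "J_extremal G" "inj_on f (verts G)"
  shows "J_extremal (image_graph f G)"
proof -
  have G: "simple_graph G"
    using assms(1) by (simp add: J_extremal_def)
  show ?thesis
    using assms(1) j_image_graph_le[OF G assms(2)] simple_image_graph[OF G assms(2)]
      card_image_graph[OF G assms(2)]
    unfolding J_extremal_def by (metis le_trans)
qed

section \<open>The edge exchange\<close>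

text \<open>An injection \<open>F\<close> from the old homomorphisms to the new ones misses a new
  one. The edge at \<open>v\<close> serves to keep \<open>v\<close> away from c, a value that the
  new edge \<open>uv\<close> forbids.\<close>

lemma j_edge_exchange_less:
  fixes G :: "'a graph" and u v x y :: 'a
  defines "G' \<equiv> Graph (verts G) (insert {u, v} (edges G - {{x, y}}))"
  assumes G: "simple_graph G"
    and xy: "{x, y} \<in> edges G" and uv: "u \<in> verts G" "v \<in> verts G" "u \<noteq> v" "{u, v} \<notin> edges G"
    and ux: "{u, x} \<in> edges G" and uy: "{u, y} \<in> edges G"
    and vx: "{v, x} \<notin> edges G" and vy: "{v, y} \<notin> edges G"
    and v: "{v, w} \<in> edges G"
    and Nx: "\<And>z. {x, z} \<in> edges G \<Longrightarrow> z \<noteq> u \<Longrightarrow> {u, z} \<in> edges G"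
    and Ny: "\<And>z. {y, z} \<in> edges G \<Longrightarrow> z \<noteq> u \<Longrightarrow> {u, z} \<in> edges G"
  shows "j G < j G'"
proof -
  note simple = simple_graph_edgeD[OF G]
  have ne: "x \<noteq> y" "u \<noteq> x" "u \<noteq> y" "v \<noteq> x" "v \<noteq> y"
    and mem: "x \<in> verts G" "y \<in> verts G"
    using simple[OF xy] simple[OF ux] simple[OF uy] ux uy uv by (auto simp: insert_commute)
  \<comment> \<open>Only homomorphisms with \<open>u\<close> and \<open>v\<close> both at a violate
    the new edge. There the edges \<open>ux\<close> and \<open>uy\<close> force \<open>x\<close> and
    \<open>y\<close> to b, so trading a and b between \<open>u\<close> and the pair
    \<open>x\<close>, \<open>y\<close> loses no information.\<close>
  define F where "F \<phi> = (if \<phi> u = J_a \<and> \<phi> v = J_a then \<phi>(u := J_b, x := J_a, y := J_a) else \<phi>)"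
    for \<phi> :: "'a \<Rightarrow> J_vertex"
  have hom_edge: "\<phi> p \<noteq> J_c" "\<phi> q \<noteq> J_c" "\<not> (\<phi> p = J_a \<and> \<phi> q = J_a)"
    if "\<phi> \<in> homs G J" "{p, q} \<in> edges G" for \<phi> p q
    using that by (auto simp: homs_J_iff)
  have F_hom: "F \<phi> \<in> homs G' J" if \<phi>: "\<phi> \<in> homs G J" for \<phi>
  proof (cases "\<phi> u = J_a \<and> \<phi> v = J_a")
    case True
    define \<psi> where "\<psi> = \<phi>(u := J_b, x := J_a, y := J_a)"
    have \<psi>_simps: "\<psi> u = J_b" "\<psi> v = J_a" "\<psi> x = J_a" "\<psi> y = J_a"
      using True ne uv by (auto simp: \<psi>_def)
    have \<psi>_else: "\<psi> z = \<phi> z" if "z \<noteq> u" "z \<notin> {x, y}" for z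
      using that by (simp add: \<psi>_def)
    have nc: "\<psi> p \<noteq> J_c" if "{p, q} \<in> edges G" for p q
      using hom_edge(1)[OF \<phi> that] by (simp add: \<psi>_def)
    \<comment> \<open>A neighbour of \<open>x\<close> or \<open>y\<close> other than
      \<open>u\<close> is also a neighbour of \<open>u\<close>, which had the value a, so that
      neighbour cannot be at a. Raising \<open>x\<close> and \<open>y\<close> to a is therefore safe
      once the edge \<open>xy\<close> is gone.\<close>
    have xy_nbr: "\<psi> q \<noteq> J_a" if e: "{p, q} \<in> edges G" "{p, q} \<noteq> {x, y}" "p \<in> {x, y}" for p q
    proof (cases "q = u")
      case False
      then have "{u, q} \<in> edges G"
        using e Nx Ny by blast
      then have "\<phi> q \<noteq> J_a"
        using hom_edge(3)[OF \<phi>] True by blast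
      moreover have "q \<notin> {x, y}"
        using e simple(3)[OF e(1)] by blast
      ultimately show ?thesis
        using False by (simp add: \<psi>_else)
    qed (simp add: \<psi>_simps)
    have "\<psi> p \<noteq> J_c \<and> \<psi> q \<noteq> J_c \<and> \<not> (\<psi> p = J_a \<and> \<psi> q = J_a)" if e: "{p, q} \<in> edges G'" for p q
    proof (cases "{p, q} = {u, v}")
      case True
      then show ?thesis
        by (auto simp: \<psi>_simps doubleton_eq_iff)
    next
      case False
      then have pq: "{p, q} \<in> edges G" "{p, q} \<noteq> {x, y}"
        using e by (auto simp: G'_def)
      then have qp: "{q, p} \<in> edges G" "{q, p} \<noteq> {x, y}"
        by (simp_all add: insert_commute)
      have "\<not> (\<psi> p = J_a \<and> \<psi> q = J_a)"
      proof (cases "p \<in> {x, y} \<or> q \<in> {x, y}")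
        case True
        then show ?thesis
          using xy_nbr[OF pq] xy_nbr[OF qp] by blast
      next
        case False
        then show ?thesis
          using hom_edge(3)[OF \<phi> pq(1)] \<psi>_else[of p] \<psi>_else[of q] \<psi>_simps(1)
          by (metis J_vertex.distinct(1))
      qed
      then show ?thesis
        using nc[OF pq(1)] nc[OF qp(1)] by blast
    qed
    moreover have "\<psi> \<in> extensional (verts G')"
      using \<phi> mem uv by (auto simp: homs_J_iff G'_def \<psi>_def extensional_def)
    ultimately show ?thesis
      using True by (auto simp: homs_J_iff F_def \<psi>_def)
  next
    case False
    \<comment> \<open>Both \<open>u\<close> and \<open>v\<close> lie on edges of \<open>G\<close>,
      so neither goes to c. As they are not both at a, the unchanged map respects the new
      edge.\<close>
    have "\<phi> u \<noteq> J_c" "\<phi> v \<noteq> J_c"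
      using hom_edge(1)[OF \<phi> ux] hom_edge(1)[OF \<phi> v] by auto
    then have "\<phi> p \<noteq> J_c \<and> \<phi> q \<noteq> J_c \<and> \<not> (\<phi> p = J_a \<and> \<phi> q = J_a)"
      if e: "{p, q} \<in> edges G'" for p q
    proof -
      have "{p, q} = {u, v} \<or> {p, q} \<in> edges G"
        using e by (auto simp: G'_def)
      then show ?thesis
        using \<open>\<phi> u \<noteq> J_c\<close> \<open>\<phi> v \<noteq> J_c\<close> False hom_edge[OF \<phi>, of p q]
        unfolding doubleton_eq_iff by blast
    qed
    moreover have "\<phi> \<in> extensional (verts G')"
      using \<phi> by (simp add: homs_J_iff G'_def)
    moreover have "F \<phi> = \<phi>"
      unfolding F_def using False by (rule if_not_P)
    ultimately show ?thesis
      by (simp add: homs_J_iff)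
  qed
  have "inj_on F (homs G J)"
  proof (rule inj_onI)
    fix \<phi> \<psi> assume h: "\<phi> \<in> homs G J" "\<psi> \<in> homs G J" and eq: "F \<phi> = F \<psi>"
    have not_a: "\<not> (\<phi> x = J_a \<and> \<phi> y = J_a)" "\<not> (\<psi> x = J_a \<and> \<psi> y = J_a)"
      using hom_edge[OF h(1) xy] hom_edge[OF h(2) xy] by auto
    have b: "\<phi> x = J_b \<and> \<phi> y = J_b" if "\<phi> \<in> homs G J" "\<phi> u = J_a" for \<phi>
      using hom_edge[OF that(1) ux] hom_edge[OF that(1) uy] that(2)
      by (cases "\<phi> x"; cases "\<phi> y") auto
    have pt: "F \<phi> z = F \<psi> z" for z
      using eq by simp
    \<comment> \<open>The edge \<open>xy\<close> of \<open>G\<close> keeps \<open>x\<close> and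
      \<open>y\<close> from both being at a before \<open>F\<close> is applied, so seeing both at a
      afterwards reveals that the map was changed.\<close>
    have same: "\<phi> u = J_a \<and> \<phi> v = J_a \<longleftrightarrow> \<psi> u = J_a \<and> \<psi> v = J_a"
      using pt[of x] pt[of y] not_a ne by (auto simp: F_def split: if_splits)
    show "\<phi> = \<psi>"
    proof
      fix z
      show "\<phi> z = \<psi> z"
        using pt[of z] same b[OF h(1)] b[OF h(2)] by (auto simp: F_def split: if_splits)
    qed
  qed
  moreover
  text \<open>No \<open>F \<phi>\<close> maps \<open>x, y\<close> to \<open>a\<close> and \<open>v\<close> to \<open>b\<close>, so the following homomorphism is not in the
    image of \<open>F\<close>.\<close>
  define \<chi> where "\<chi> = (\<lambda>z\<in>verts G. if z = x \<or> z = y then J_a else J_b)"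
  have \<chi>_simps: "\<chi> z = (if z = x \<or> z = y then J_a else J_b)" if "z \<in> verts G" for z
    using that by (simp add: \<chi>_def)
  have "\<chi> \<in> homs G' J"
    unfolding homs_J_iff
  proof (intro conjI[of "_ \<in> extensional _"] allI impI)
    show "\<chi> \<in> extensional (verts G')"
      by (simp add: G'_def \<chi>_def)
    fix p q assume e: "{p, q} \<in> edges G'"
    have "p \<in> verts G" "q \<in> verts G" "p \<noteq> q"
      using e simple[of p q] uv by (auto simp: G'_def doubleton_eq_iff)
    moreover have "{p, q} \<noteq> {x, y}"
      using e ne by (auto simp: G'_def doubleton_eq_iff)
    ultimately show "\<chi> p \<noteq> J_c \<and> \<chi> q \<noteq> J_c \<and> \<not> (\<chi> p = J_a \<and> \<chi> q = J_a)"
      by (auto simp: \<chi>_simps)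
  qed
  moreover have "\<chi> \<notin> F ` homs G J"
  proof
    assume "\<chi> \<in> F ` homs G J"
    then obtain \<phi> where \<phi>: "\<phi> \<in> homs G J" "\<chi> = F \<phi>"
      by auto
    have "F \<phi> x = J_a" "F \<phi> y = J_a" "F \<phi> v = J_b"
      using \<chi>_simps mem uv ne unfolding \<phi>(2)[symmetric] by auto
    then show False
      using hom_edge[OF \<phi>(1) xy] ne uv by (auto simp: F_def split: if_splits)
  qed
  ultimately have "F ` homs G J \<subset> homs G' J" "card (F ` homs G J) = card (homs G J)"
    using F_hom by (auto simp: card_image)
  moreover have "finite (homs G' J)"
    using G by (simp add: finite_homs_J G'_def simple_graph_def)
  ultimately show ?thesis
    unfolding j_def by (metis psubset_card_mono)
qed

text \<open>This is the only place where extremality enters the structural argument. With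
  \<open>u < x < y\<close>, nesting places the neighbours of \<open>x\<close> and \<open>y\<close>
  among those of \<open>u\<close>, so a missing edge \<open>uv\<close> would permit the exchange.
  The position of \<open>v\<close> in the order is arbitrary.\<close>

lemma J_extremal_nested_imp_edge:
  fixes G :: "nat graph"
  assumes ext: "J_extremal G"
    and nested: "\<And>x y z. x \<in> verts G \<Longrightarrow> x < y \<Longrightarrow> {y, z} \<in> edges G \<Longrightarrow> z \<noteq> x \<Longrightarrow> {x, z} \<in> edges G"
    and xy: "{x, y} \<in> edges G" "x < y" and u: "u \<in> verts G" "u < x"
    and v: "v \<noteq> u" "{v, w} \<in> edges G"
  shows "{u, v} \<in> edges G"
proof (rule ccontr)
  assume uv: "{u, v} \<notin> edges G"
  have G: "simple_graph G"
    using ext by (simp add: J_extremal_def)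
  have N: "{u, z} \<in> edges G" if "{x, z} \<in> edges G \<or> {y, z} \<in> edges G" "z \<noteq> u" for z
    using nested[of u x z] nested[of u y z] that u xy(2) by auto
  \<comment> \<open>Each of \<open>x\<close> and \<open>y\<close> is a neighbour of the other, hence
    a neighbour of \<open>u\<close>. Conversely, \<open>v\<close> adjacent to \<open>x\<close> or
    \<open>y\<close> would be adjacent to \<open>u\<close>.\<close>
  have ux: "{u, x} \<in> edges G" and uy: "{u, y} \<in> edges G"
    using N[of x] N[of y] xy u by (auto simp: insert_commute)
  have vx: "{v, x} \<notin> edges G" and vy: "{v, y} \<notin> edges G"
    using N[of v] uv v(1) by (auto simp: insert_commute)
  define G' where "G' = Graph (verts G) (insert {u, v} (edges G - {{x, y}}))"
  have vV: "v \<in> verts G"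
    using simple_graph_edgeD[OF G v(2)] by simp
  have "j G < j G'"
    unfolding G'_def using j_edge_exchange_less[OF G xy(1) u(1) vV v(1)[symmetric] uv ux uy vx vy v(2)] N
    by blast
  moreover have "simple_graph G'"
    using G u vV v(1) by (auto simp: simple_graph_def G'_def)
  moreover have "finite (edges G)"
    using G finite_imp_finite_nsets by (auto simp: simple_graph_def intro: finite_subset)
  then have "card (edges G') = card (edges G)"
    using uv card_Suc_Diff1[OF _ xy(1)] by (simp add: G'_def del: card_Diff_insert card_Diff_singleton)
  ultimately show False
    using ext unfolding J_extremal_def by (metis G'_def graph.sel(1) not_le)
qed

section \<open>Nested neighbourhoods in threshold graphs\<close>

text \<open>Integer positions leave room at both ends: a dominating vertex is placed before all
  others and an isolated one after them, with no renumbering. Finiteness and the bound on edges are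
  carried through the induction so that the extreme positions exist and old edges avoid the new
  vertex.\<close>

lemma threshold_graph_nested_order:
  assumes "threshold_graph T"
  shows "finite (verts T) \<and> (\<forall>e \<in> edges T. e \<subseteq> verts T) \<and>
    (\<exists>f :: 'a \<Rightarrow> int. inj_on f (verts T) \<and>
      (\<forall>x \<in> verts T. \<forall>y z. f x < f y \<longrightarrow> y \<in> verts T \<longrightarrow> {y, z} \<in> edges T \<longrightarrow> z \<noteq> x \<longrightarrow> {x, z} \<in> edges T))"
  using assms
proof induction
  case (K1 v)
  then show ?case by auto
next
  case (dominating V E v)
  then obtain f :: "'a \<Rightarrow> int" where f: "finite V" "\<And>e. e \<in> E \<Longrightarrow> e \<subseteq> V" "inj_on f V"
    "\<And>x y z. x \<in> V \<Longrightarrow> y \<in> V \<Longrightarrow> f x < f y \<Longrightarrow> {y, z} \<in> E \<Longrightarrow> z \<noteq> x \<Longrightarrow> {x, z} \<in> E"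
    by auto
  define g where "g = f(v := Min (f ` V) - 1)"
  have lt: "g v < g x" if "x \<in> V" for x
  proof -
    have "Min (f ` V) \<le> f x"
      using that f(1) by simp
    then show ?thesis
      using that \<open>v \<notin> V\<close> by (auto simp: g_def)
  qed
  have gf: "g x = f x" if "x \<in> V" for x
    using that \<open>v \<notin> V\<close> by (auto simp: g_def)
  have "inj_on g V"
    using f(3) gf by (simp cong: inj_on_cong)
  moreover have "g v \<notin> g ` V"
    using lt by (metis imageE less_irrefl)
  ultimately have inj: "inj_on g (insert v V)"
    using \<open>v \<notin> V\<close> by simp
  let ?E = "E \<union> {{u, v} |u. u \<in> V}"
  have "{x, z} \<in> ?E" if "x \<in> insert v V" "y \<in> insert v V" "g x < g y" "{y, z} \<in> ?E" "z \<noteq> x" for x y z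
  proof -
    have sub: "z \<in> insert v V"
      using that(4) f(2) by (auto simp: doubleton_eq_iff)
    \<comment> \<open>The new vertex comes first, so it cannot be the later vertex
      \<open>y\<close>.\<close>
    have "y \<in> V"
      using that lt by (metis insertE less_asym less_irrefl)
    show ?thesis
    proof (cases "x = v \<or> z = v")
      case True
      then show ?thesis
        using that(1,5) sub by (auto simp: doubleton_eq_iff)
    next
      case False
      then have "{y, z} \<in> E" "x \<in> V"
        using that \<open>y \<in> V\<close> \<open>v \<notin> V\<close> by (auto simp: doubleton_eq_iff)
      then show ?thesis
        using f(4)[of x y z] that gf \<open>y \<in> V\<close> by auto
    qed
  qed
  moreover have "\<forall>e \<in> ?E. e \<subseteq> insert v V"
    using f(2) by blast
  ultimately show ?case
    using f(1) inj by (simp only: graph.sel finite_insert) blast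
next
  case (isolated V E v)
  then obtain f :: "'a \<Rightarrow> int" where f: "finite V" "\<And>e. e \<in> E \<Longrightarrow> e \<subseteq> V" "inj_on f V"
    "\<And>x y z. x \<in> V \<Longrightarrow> y \<in> V \<Longrightarrow> f x < f y \<Longrightarrow> {y, z} \<in> E \<Longrightarrow> z \<noteq> x \<Longrightarrow> {x, z} \<in> E"
    by auto
  define g where "g = f(v := Max (f ` V) + 1)"
  have lt: "g x < g v" if "x \<in> V" for x
  proof -
    have "f x \<le> Max (f ` V)"
      using that f(1) by simp
    then show ?thesis
      using that \<open>v \<notin> V\<close> by (auto simp: g_def)
  qed
  have gf: "g x = f x" if "x \<in> V" for x
    using that \<open>v \<notin> V\<close> by (auto simp: g_def)
  have "inj_on g V"
    using f(3) gf by (simp cong: inj_on_cong)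
  moreover have "g v \<notin> g ` V"
    using lt by (metis imageE less_irrefl)
  ultimately have inj: "inj_on g (insert v V)"
    using \<open>v \<notin> V\<close> by simp
  have "{x, z} \<in> E" if "x \<in> insert v V" "g x < g y" "{y, z} \<in> E" "z \<noteq> x" for x y z
  proof -
    \<comment> \<open>The later vertex \<open>y\<close> lies on an old edge, so it is old;
      \<open>x\<close> precedes it and hence is not the new last vertex.\<close>
    have "y \<in> V"
      using that f(2) by blast
    moreover have "x \<in> V"
      using that lt \<open>y \<in> V\<close> by (metis insertE less_asym)
    ultimately show ?thesis
      using f(4)[of x y z] that gf by auto
  qed
  moreover have "\<forall>e \<in> E. e \<subseteq> insert v V"
    using f(2) by blast
  ultimately show ?case
    using f(1) inj by (simp only: graph.sel finite_insert) blast
qed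

lemma ex_strict_mono_enumeration:
  fixes A :: "int set"
  assumes "finite A"
  shows "\<exists>h. bij_betw h A {1..card A} \<and> strict_mono_on A h"
proof -
  \<comment> \<open>Counting \<open>a\<close> itself makes the ranks start at 1.\<close>
  define h where "h a = card {b \<in> A. b \<le> a}" for a
  have mono: "h a < h b" if "a \<in> A" "b \<in> A" "a < b" for a b
  proof -
    have "b \<notin> {c \<in> A. c \<le> a}" "b \<in> {c \<in> A. c \<le> b}"
      using that by auto
    then have "{c \<in> A. c \<le> a} \<subset> {c \<in> A. c \<le> b}"
      using \<open>a < b\<close> by force
    then show ?thesis
      unfolding h_def using assms by (intro psubset_card_mono) auto
  qed
  then have inj: "inj_on h A"
    by (metis inj_onI less_irrefl linorder_neqE)
  have "h ` A \<subseteq> {1..card A}"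
  proof
    fix i assume "i \<in> h ` A"
    then obtain a where a: "a \<in> A" "i = h a"
      by auto
    have "h a \<le> card A"
      unfolding h_def using assms by (intro card_mono) auto
    moreover have "h a \<noteq> 0"
      using a assms by (auto simp: h_def)
    ultimately show "i \<in> {1..card A}"
      using a by auto
  qed
  then have "h ` A = {1..card A}"
    using inj by (intro card_subset_eq) (auto simp: card_image)
  then show ?thesis
    using inj mono by (auto simp: bij_betw_def strict_mono_on_def)
qed

lemma threshold_graph_nested_enumeration:
  assumes "threshold_graph T"
  obtains f where "bij_betw f (verts T) {1..card (verts T)}"
    and "\<And>x y z. x \<in> verts T \<Longrightarrow> y \<in> verts T \<Longrightarrow> f x < f y \<Longrightarrow> {y, z} \<in> edges T \<Longrightarrow> z \<noteq> x \<Longrightarrow>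
           {x, z} \<in> edges T"
proof -
  obtain g :: "'a \<Rightarrow> int" where g: "inj_on g (verts T)" "finite (verts T)"
    "\<And>x y z. x \<in> verts T \<Longrightarrow> y \<in> verts T \<Longrightarrow> g x < g y \<Longrightarrow> {y, z} \<in> edges T \<Longrightarrow> z \<noteq> x \<Longrightarrow>
       {x, z} \<in> edges T"
    using threshold_graph_nested_order[OF assms] by blast
  obtain h where h: "bij_betw h (g ` verts T) {1..card (verts T)}" "strict_mono_on (g ` verts T) h"
    using ex_strict_mono_enumeration[of "g ` verts T"] g by (auto simp: card_image)
  show ?thesis
  proof
    show "bij_betw (h \<circ> g) (verts T) {1..card (verts T)}"
      using bij_betw_trans[OF inj_on_imp_bij_betw[OF g(1)] h(1)] .
    fix x y z assume "x \<in> verts T" "y \<in> verts T" "(h \<circ> g) x < (h \<circ> g) y" "{y, z} \<in> edges T" "z \<noteq> x"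
    then show "{x, z} \<in> edges T"
      using g(3)[of x y z] strict_mono_on_less[OF h(2)] by auto
  qed
qed

section \<open>Initial segments of the lexicographic order\<close>

text \<open>If the smaller elements differ, the lesser of them lies in only one pair and is the
  minimum of the symmetric difference. If they agree, they cancel and the larger elements
  decide.\<close>

lemma lex_less_doubleton_iff:
  assumes "a < b" "c < d"
  shows "lex_less {a, b} {c, d} \<longleftrightarrow> a < c \<or> a = c \<and> b < d"
proof -
  let ?D = "sym_diff {a, b} {c, d}"
  have Min: "Min ?D = z" if "z \<in> ?D" "\<And>w. w \<in> ?D \<Longrightarrow> z \<le> w" for z
    using that by (intro Min_eqI) auto
  consider "a < c" | "c < a" | "a = c" "b < d" | "a = c" "d < b" | "a = c" "b = d"
    by linarith
  then show ?thesis
  proof cases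
    case 1
    then have "Min ?D = a"
      using assms by (intro Min) auto
    then show ?thesis
      unfolding lex_less_def using 1 assms by (simp add: doubleton_eq_iff)
  next
    case 2
    then have "Min ?D = c"
      using assms by (intro Min) auto
    then show ?thesis
      unfolding lex_less_def using 2 assms by (simp add: doubleton_eq_iff)
  next
    case 3
    then have "Min ?D = b"
      using assms by (intro Min) auto
    then show ?thesis
      unfolding lex_less_def using 3 assms by (simp add: doubleton_eq_iff)
  next
    case 4
    then have "Min ?D = d"
      using assms by (intro Min) auto
    then show ?thesis
      unfolding lex_less_def using 4 assms by (simp add: doubleton_eq_iff)
  next
    case 5
    then show ?thesis
      by (simp add: lex_less_def)
  qed
qed

lemma nsets2_orderedE:
  fixes A :: "'a :: linorder set"
  assumes "e \<in> [A]\<^bsup>2\<^esup>"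
  obtains a b where "e = {a, b}" "a < b" "a \<in> A" "b \<in> A"
proof -
  obtain x y where xy: "e = {x, y}" "x \<in> A" "y \<in> A" "x \<noteq> y"
    using assms by (rule nsets2_E)
  then show ?thesis
    using that[of x y] that[of y x] by (cases x y rule: linorder_cases) (auto simp: insert_commute)
qed

text \<open>An element of \<open>F\<close> has all its predecessors in \<open>F\<close> and is not
  its own predecessor, so there are fewer than \<open>card F\<close> of them. For an element outside
  \<open>F\<close>, totality and downward closure put all of \<open>F\<close> before it.\<close>

lemma initial_segment_eq_rank_less:
  assumes "finite P" "F \<subseteq> P"
    and irrefl: "\<And>e. e \<in> P \<Longrightarrow> \<not> lt e e"
    and total: "\<And>e f. e \<in> P \<Longrightarrow> f \<in> P \<Longrightarrow> e \<noteq> f \<Longrightarrow> lt e f \<or> lt f e"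
    and down: "\<And>e f. e \<in> P \<Longrightarrow> f \<in> F \<Longrightarrow> lt e f \<Longrightarrow> e \<in> F"
  shows "{e \<in> P. card {f \<in> P. lt f e} < card F} = F"
proof -
  have finF: "finite F"
    using assms finite_subset by blast
  have "card {f \<in> P. lt f e} < card F \<longleftrightarrow> e \<in> F" if e: "e \<in> P" for e
  proof
    assume "e \<in> F"
    then have "{f \<in> P. lt f e} \<subset> F"
      using down irrefl e by blast
    then show "card {f \<in> P. lt f e} < card F"
      using finF psubset_card_mono by blast
  next
    assume less: "card {f \<in> P. lt f e} < card F"
    show "e \<in> F"
    proof (rule ccontr)
      assume "e \<notin> F"
      then have "F \<subseteq> {f \<in> P. lt f e}"
        using total down e \<open>F \<subseteq> P\<close> by blast
      then have "card F \<le> card {f \<in> P. lt f e}"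
        using assms(1) by (intro card_mono) auto
      then show False
        using less by simp
    qed
  qed
  then show ?thesis
    using \<open>F \<subseteq> P\<close> by blast
qed

lemma edges_lex_graph_eq:
  assumes "F \<subseteq> [{1..q}]\<^bsup>2\<^esup>"
    and down: "\<And>a b c d. a \<in> {1..q} \<Longrightarrow> b \<in> {1..q} \<Longrightarrow> a < b \<Longrightarrow> c < d \<Longrightarrow> {c, d} \<in> F \<Longrightarrow>
      a < c \<or> a = c \<and> b < d \<Longrightarrow> {a, b} \<in> F"
  shows "edges (lex_graph q (card F)) = F"
proof -
  let ?P = "[{1..q}]\<^bsup>2\<^esup>"
  have "{e \<in> ?P. card {f \<in> ?P. lex_less f e} < card F} = F"
  proof (rule initial_segment_eq_rank_less)
    show "finite ?P"
      by (simp add: finite_imp_finite_nsets)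
    show "\<not> lex_less e e" for e
      by (simp add: lex_less_def)
    show "lex_less e f \<or> lex_less f e" if "e \<in> ?P" "f \<in> ?P" "e \<noteq> f" for e f
      using that by (elim nsets2_orderedE) (auto simp: lex_less_doubleton_iff)
    show "e \<in> F" if e: "e \<in> ?P" and f: "f \<in> F" and lt: "lex_less e f" for e f
    proof -
      obtain a b where ab: "e = {a, b}" "a < b" "a \<in> {1..q}" "b \<in> {1..q}"
        using e by (rule nsets2_orderedE)
      obtain c d where cd: "f = {c, d}" "c < d"
        using f assms(1) by (meson nsets2_orderedE subsetD)
      show ?thesis
        using down[OF ab(3,4,2) cd(2)] f lt unfolding ab(1) cd(1) lex_less_doubleton_iff[OF ab(2) cd(2)]
        by blast
    qed
  qed (use assms in auto)
  then show ?thesis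
    by (simp add: lex_graph_def)
qed

section \<open>Splitting off the isolated vertices and assembling the result\<close>

lemma graph_iso_disjoint_union_empty_graph:
  assumes "verts G = {1..n}" "q \<le> n" "verts H = {1..q}" "edges H = edges G" "simple_graph H"
  shows "graph_iso G (disjoint_union H (empty_graph (n - q)))"
proof -
  \<comment> \<open>The shift by \<open>q\<close> matches the vertices of
    \<open>empty_graph\<close>, which start at 1.\<close>
  let ?f = "\<lambda>i. if i \<le> q then Inl i else Inr (i - q)"
  have "bij_betw ?f {1..n} ({1..q} <+> {1..n - q})"
    by (rule bij_betwI[where g = "case_sum id (\<lambda>i. i + q)"]) (use assms(2) in \<open>auto simp: Suc_le_eq diff_le_mono split: if_splits\<close>)
  moreover have "{x, y} \<in> edges G \<longleftrightarrow> {?f x, ?f y} \<in> (`) Inl ` edges G" for x y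
  proof
    assume e: "{x, y} \<in> edges G"
    then have "{?f x, ?f y} = Inl ` {x, y}"
      using simple_graph_edgeD[OF assms(5), of x y] assms(3,4) by auto
    then show "{?f x, ?f y} \<in> (`) Inl ` edges G"
      using e by (metis imageI)
  next
    assume "{?f x, ?f y} \<in> (`) Inl ` edges G"
    then obtain e where e: "e \<in> edges G" "{?f x, ?f y} = Inl ` e"
      by blast
    \<comment> \<open>A value in the range of \<open>Inl\<close> can only come from the first branch
      of \<open>?f\<close>.\<close>
    then have "?f x \<in> range Inl" "?f y \<in> range Inl"
      by blast+
    then have "?f x = Inl x" "?f y = Inl y"
      by (auto split: if_splits)
    then have "(Inl :: nat \<Rightarrow> nat + nat) ` e = Inl ` {x, y}"
      using e(2) by (simp only: image_insert image_empty)
    then have "e = {x, y}"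
      by (metis inj_Inl inj_image_eq_iff)
    then show "{x, y} \<in> edges G"
      using e(1) by simp
  qed
  ultimately show ?thesis
    unfolding graph_iso_def
    by (intro exI[of _ ?f]) (simp add: disjoint_union_def empty_graph_def assms)
qed

text \<open>Nesting makes the non-isolated vertices an interval starting at 1, and \<open>q\<close>
  is their number. A pair that precedes an edge lexicographically is then an edge: by the exchange
  if its smaller element is smaller, by nesting alone if the smaller elements agree.\<close>

lemma J_extremal_nested_iso_lex_graph:
  fixes G :: "nat graph"
  assumes ext: "J_extremal G" and V: "verts G = {1..n}"
    and nested: "\<And>x y z. x \<in> verts G \<Longrightarrow> x < y \<Longrightarrow> {y, z} \<in> edges G \<Longrightarrow> z \<noteq> x \<Longrightarrow> {x, z} \<in> edges G"
  shows "\<exists>q. q \<le> n \<and> card (edges G) \<le> q choose 2 \<and>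
    graph_iso G (disjoint_union (lex_graph q (card (edges G))) (empty_graph (n - q)))"
proof -
  have G: "simple_graph G"
    using ext by (simp add: J_extremal_def)
  define N where "N = \<Union> (edges G)"
  have N_iff: "v \<in> N \<longleftrightarrow> (\<exists>w. {v, w} \<in> edges G)" for v
  proof
    assume "v \<in> N"
    then obtain e where e: "e \<in> edges G" "v \<in> e"
      by (auto simp: N_def)
    from G e(1) obtain x y where "e = {x, y}" "x \<in> verts G" "y \<in> verts G" "x \<noteq> y"
      by (rule simple_graph_edgeE)
    then show "\<exists>w. {v, w} \<in> edges G"
      using e by (auto simp: insert_commute)
  qed (auto simp: N_def)
  have N_sub: "N \<subseteq> {1..n}"
    using simple_graph_edgeD[OF G] by (auto simp: N_iff V)
  have N_down: "x \<in> N" if "y \<in> N" "1 \<le> x" "x < y" for x y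
  proof -
    obtain z where z: "{y, z} \<in> edges G"
      using \<open>y \<in> N\<close> N_iff by blast
    show ?thesis
    proof (cases "z = x")
      case True
      then show ?thesis
        using z unfolding N_iff by (metis insert_commute)
    next
      case False
      have "x \<in> verts G"
        using that N_sub V by auto
      then show ?thesis
        using nested[OF _ \<open>x < y\<close> z False] N_iff by blast
    qed
  qed
  \<comment> \<open>Inserting 0 yields \<open>q = 0\<close> for an edgeless graph.\<close>
  define q where "q = Max (insert 0 N)"
  have finN: "finite N"
    using N_sub finite_subset by blast
  have N_eq: "N = {1..q}"
  proof
    show "N \<subseteq> {1..q}"
      using N_sub finN by (auto simp: q_def)
    show "{1..q} \<subseteq> N"
    proof
      fix x assume x: "x \<in> {1..q}"
      have "q \<in> insert 0 N"
        unfolding q_def using finN by (intro Max_in) auto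
      then have "q \<in> N"
        using x by auto
      then show "x \<in> N"
        using N_down[of q x] x by (cases "x = q") auto
    qed
  qed
  have "q \<le> n"
    unfolding q_def using finN N_sub by auto
  have "edges G \<subseteq> [N]\<^bsup>2\<^esup>"
    using G by (auto simp: N_def simple_graph_def nsets_def)
  then have sub: "edges G \<subseteq> [{1..q}]\<^bsup>2\<^esup>"
    unfolding N_eq .
  have "card (edges G) \<le> card ([{1..q}]\<^bsup>2\<^esup>)"
    using sub by (intro card_mono) (simp_all add: finite_imp_finite_nsets)
  then have "card (edges G) \<le> q choose 2"
    by (simp add: card_nsets)
  moreover have lex: "edges (lex_graph q (card (edges G))) = edges G"
  proof (rule edges_lex_graph_eq[OF sub])
    fix a b c d
    assume ab: "a \<in> {1..q}" "b \<in> {1..q}" "a < b" and cd: "c < d" "{c, d} \<in> edges G"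
      and lt: "a < c \<or> a = c \<and> b < d"
    show "{a, b} \<in> edges G"
      using lt
    proof
      assume "a < c"
      \<comment> \<open>As \<open>b\<close> is at most \<open>q\<close>, it is non-isolated, which
        is what the exchange asks of it.\<close>
      obtain w where "{b, w} \<in> edges G"
        using ab(2) N_iff unfolding N_eq by blast
      then show ?thesis
        using J_extremal_nested_imp_edge[OF ext nested cd(2,1) _ \<open>a < c\<close>] ab \<open>q \<le> n\<close> V by auto
    next
      assume "a = c \<and> b < d"
      then show ?thesis
        using nested[of b d a] ab cd \<open>q \<le> n\<close> V by (auto simp: insert_commute)
    qed
  qed
  moreover have "graph_iso G (disjoint_union (lex_graph q (card (edges G))) (empty_graph (n - q)))"
  proof (rule graph_iso_disjoint_union_empty_graph[OF V \<open>q \<le> n\<close> _ lex])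
    show "verts (lex_graph q (card (edges G))) = {1..q}"
      by (simp add: lex_graph_def)
    show "simple_graph (lex_graph q (card (edges G)))"
      by (auto simp: simple_graph_def lex_graph_def)
  qed
  ultimately show ?thesis
    using \<open>q \<le> n\<close> by blast
qed

theorem theorem3p1:
  fixes T :: "'a graph" and n m :: nat
  assumes "n \<ge> 1" and "m \<le> n choose 2"
    and "threshold_graph T"
    and "card (verts T) = n" and "card (edges T) = m"
    and "J_extremal T"
  shows "\<exists>q. q \<le> n \<and> m \<le> q choose 2 \<and>
           graph_iso T (disjoint_union (lex_graph q m) (empty_graph (n - q)))"
proof -
  have T: "simple_graph T"
    using assms(6) by (simp add: J_extremal_def)
  obtain f where f: "bij_betw f (verts T) {1..n}"
    and nested: "\<And>x y z. x \<in> verts T \<Longrightarrow> y \<in> verts T \<Longrightarrow> f x < f y \<Longrightarrow> {y, z} \<in> edges T \<Longrightarrow>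
      z \<noteq> x \<Longrightarrow> {x, z} \<in> edges T"
    using threshold_graph_nested_enumeration[OF assms(3)] assms(4) by metis
  have inj: "inj_on f (verts T)"
    using f by (simp add: bij_betw_def)
  \<comment> \<open>Relabelling by position turns the nested order into the usual order on 1, ...,
    n.\<close>
  let ?G = "image_graph f T"
  have V: "verts ?G = f ` verts T"
    by (simp add: image_graph_def)
  have "{x, z} \<in> edges ?G" if "x \<in> verts ?G" "x < y" "{y, z} \<in> edges ?G" "z \<noteq> x" for x y z
  proof -
    have "y \<in> f ` verts T" "z \<in> f ` verts T"
      using simple_graph_edgeD[OF simple_image_graph[OF T inj] that(3)] V by auto
    moreover have "x \<in> f ` verts T"
      using that(1) V by simp
    ultimately obtain x' y' z' where "x = f x'" "y = f y'" "z = f z'"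
      and "x' \<in> verts T" "y' \<in> verts T" "z' \<in> verts T"
      by (elim imageE)
    then show ?thesis
      using that nested[of x' y' z'] edge_image_graph_iff[OF T inj] by auto
  qed
  then obtain q where "q \<le> n" "m \<le> q choose 2"
    "graph_iso ?G (disjoint_union (lex_graph q m) (empty_graph (n - q)))"
    using J_extremal_nested_iso_lex_graph[OF J_extremal_image_graph[OF assms(6) inj], of n] f V
      card_image_graph(2)[OF T inj] assms(5) by (auto simp: bij_betw_def)
  then show ?thesis
    using graph_iso_trans[OF graph_iso_image_graph[OF T inj]] by blast
qed

end
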